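(* Let $\varphi:\mathbb{R}^2\to\mathbb{C}$ be the function $$\varphi(x,y)=\frac{1}{3}\left(e^{\mathrm{i}x}+e^{\mathrm{i}y}+e^{\mathrm{i}(x+y)}\right),\qquad (x,y)\in\mathbb{R}^2,$$ which is the characteristic function of the probability distribution $\mu=\frac13\delta_{(0,1)}+\frac13\delta_{(1,0)}+\frac13\delta_{(1,1)}$ on $\mathbb{R}^2$. Then $\varphi$ cannot be approximated arbitrarily well by zero-free continuous functions from $\mathbb{R}^2$ to $\mathbb{C}$ with respect to local uniform convergence; that is, there is no sequence $(g_n)_{n\in\mathbb{N}}$ of continuous functions $g_n:\mathbb{R}^2\to\mathbb{C}$ with $g_n(x,y)\neq 0$ for all $(x,y)\in\mathbb{R}^2$ and all $n\in\mathbb{N}$, such that $g_n\to\varphi$ uniformly on every compact subset of $\mathbb{R}^2$ as $n\to\infty$.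
   Context: $\delta_a$ denotes the Dirac measure at the point $a\in\mathbb{R}^2$. The characteristic function of a Borel probability measure $\mu$ on $\mathbb{R}^2$ is $\widehat{\mu}(t)=\int_{\mathbb{R}^2}e^{\mathrm{i}\langle t,z\rangle}\,\mu(\mathrm{d}z)$, $t\in\mathbb{R}^2$. A function is zero-free if it vanishes nowhere on its domain. Local uniform convergence means uniform convergence on every compact subset. *)

theory Defs
  imports "HOL-Probability.Probability"
begin

text \<open>
  The library constant \<^const>\<open>char\<close> only covers measures on the real line; this is the
  multivariate version.
\<close>

definition char_fun :: "'a::euclidean_space measure \<Rightarrow> 'a \<Rightarrow> complex" where
  "char_fun M t = (LINT z|M. iexp (t \<bullet> z))"

text \<open>
  \<^term>\<open>return borel a\<close> is the Dirac measure at \<open>a\<close>. There is no addition on the type of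
  measures, so the convex combination is given by its values on Borel sets.
\<close>

definition mu :: "(real \<times> real) measure" where
  "mu = measure_of UNIV (sets borel)
     (\<lambda>A. 1/3 * emeasure (return borel (0, 1)) A
        + 1/3 * emeasure (return borel (1, 0)) A
        + 1/3 * emeasure (return borel (1, 1)) A)"

definition phi :: "real \<times> real \<Rightarrow> complex" where
  "phi = (\<lambda>(x, y). 1/3 * (iexp x + iexp y + iexp (x + y)))"

end

theory Submission imports Defs begin

text \<open>
  The zero \<open>(2 * pi / 3, - 2 * pi / 3)\<close> of the characteristic function is nondegenerate, hence
  stable: if \<open>A\<close> inverts the derivative of \<open>f\<close> at a zero \<open>z\<close>, then \<open>w \<mapsto> w - A (f w)\<close> halves the
  distance to \<open>z\<close> on a small ball, so \<open>w \<mapsto> w - A (g w)\<close> maps this ball into itself for every \<open>g\<close>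
  close to \<open>f\<close>. Its Brouwer fixed point is a zero of \<open>g\<close>.
\<close>

lemma nondegenerate_zero_stable:
  fixes f :: "'a::euclidean_space \<Rightarrow> 'b::real_normed_vector"
  assumes f: "(f has_derivative f') (at z)" and z: "f z = 0"
    and A: "bounded_linear A" "inj A" "\<And>v. A (f' v) = v"
    and g: "\<And>n. continuous_on UNIV (g n)"
    and lim: "\<And>K. compact K \<Longrightarrow> uniform_limit K g f sequentially"
  shows "\<forall>\<^sub>F n in sequentially. \<exists>w. g n w = 0"
proof -
  interpret A: bounded_linear A by (rule A)
  obtain C where C: "C > 0" "\<And>x. norm (A x) \<le> norm x * C"
    using A.pos_bounded by blast
  \<comment> \<open>The accuracy \<open>1 / (2 * C)\<close> compensates for \<open>A\<close>, which
    enlarges norms by at most the factor \<open>C\<close>: after applying \<open>A\<close>, the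
    linearization error is at most half the distance to \<open>z\<close>.\<close>
  obtain r where r: "r > 0"
    and fr: "\<And>w. norm (w - z) < r \<Longrightarrow> norm (f w - f z - f' (w - z)) \<le> 1 / (2 * C) * norm (w - z)"
    using f C(1) unfolding has_derivative_at_alt
    by (metis zero_less_divide_1_iff zero_less_mult_iff zero_less_numeral)
  \<comment> \<open>Since \<open>s < r\<close>, the linearization estimate holds on the whole closed
    ball and uses up at most \<open>s / 2\<close>. The tolerance \<open>s / (2 * C)\<close> for
    \<open>g n\<close> leaves the other half to the perturbation.\<close>
  define s where "s = r / 2"
  have s: "s > 0" "s < r" using r by (auto simp: s_def)
  have "\<forall>\<^sub>F n in sequentially. \<forall>w\<in>cball z s. dist (g n w) (f w) < s / (2 * C)"
    using lim[OF compact_cball, of z s] s(1) C(1) unfolding uniform_limit_iff by simp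
  then show ?thesis
  proof eventually_elim
    case (elim n)
    have "w - A (g n w) \<in> cball z s" if w: "w \<in> cball z s" for w
    proof -
      have wz: "norm (w - z) \<le> s"
        using w by (simp add: dist_norm norm_minus_commute)
      have "norm (A (f w - f' (w - z))) \<le> norm (f w - f' (w - z)) * C"
        by (rule C(2))
      also have "\<dots> \<le> (1 / (2 * C) * norm (w - z)) * C"
        using fr[of w] wz s C(1) z by (intro mult_right_mono) auto
      also have "\<dots> \<le> s / 2"
        using wz C(1) by simp
      finally have 1: "norm (A (f w - f' (w - z))) \<le> s / 2" .
      have "norm (A (g n w - f w)) \<le> norm (g n w - f w) * C"
        by (rule C(2))
      also have "\<dots> \<le> s / (2 * C) * C"
        using elim w C(1) by (intro mult_right_mono) (auto simp: dist_norm less_imp_le)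
      also have "\<dots> = s / 2"
        using C(1) by simp
      finally have 2: "norm (A (g n w - f w)) \<le> s / 2" .
      \<comment> \<open>As \<open>A (f' (w - z)) = w - z\<close>, the displacement of the image
        point from the centre splits into the linearization error and the perturbation
        error.\<close>
      have "z - (w - A (g n w)) = A (f w - f' (w - z)) + A (g n w - f w)"
        by (simp add: A.diff A(3))
      then show ?thesis
        using norm_triangle_ineq[of "A (f w - f' (w - z))" "A (g n w - f w)"] 1 2
        by (simp add: dist_norm)
    qed
    then have maps: "(\<lambda>w. w - A (g n w)) \<in> cball z s \<rightarrow> cball z s" by blast
    have cont: "continuous_on (cball z s) (\<lambda>w. w - A (g n w))"
      by (intro continuous_intros A.continuous_on continuous_on_subset[OF g]) auto
    obtain w where "w - A (g n w) = w"
      by (rule brouwer_ball[OF s(1) cont maps])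
    then have "A (g n w) = A 0" by (simp add: A.zero)
    then have "g n w = 0" by (rule injD[OF A(2)])
    then show ?case by blast
  qed
qed

text \<open>Viewing \<open>mu\<close> as the uniform law on three points turns integrals into finite
  sums. The identity map in \<open>distr\<close> only replaces the discrete sigma-algebra of the pmf
  by the Borel one.\<close>

lemma mu_eq_distr:
  "mu = distr (measure_pmf (pmf_of_set {(0, 1), (1, 0), (1, 1)})) borel (\<lambda>z. z)"
    (is "_ = ?M")
proof -
  have "emeasure ?M A = 1/3 * emeasure (return borel (0, 1)) A
        + 1/3 * emeasure (return borel (1, 0)) A + 1/3 * emeasure (return borel (1, 1)) A"
    if A: "A \<in> sets borel" for A :: "(real \<times> real) set"
  proof -
    \<comment> \<open>With the weights written as images of reals, each of the eight membership
      cases becomes real arithmetic.\<close>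
    have third: "1/3 = ennreal (1/3)" by (simp add: ennreal_divide_numeral flip: ennreal_1)
    show ?thesis using A
      by (cases "(0, 1) \<in> A"; cases "(1, 0) \<in> A"; cases "(1, 1) \<in> A")
        (simp_all add: emeasure_distr emeasure_pmf_of_set third flip: ennreal_plus)
  qed
  then have "measure_of (space ?M) (sets ?M) (emeasure ?M) = mu"
    unfolding mu_def space_distr sets_distr space_borel
    by (intro measure_of_eq) (auto simp: sets.sigma_sets_eq[of borel, simplified])
  then show ?thesis by (simp only: measure_of_of_measure)
qed

lemma prob_space_mu: "prob_space mu"
  unfolding mu_eq_distr by (intro prob_space.prob_space_distr prob_space_measure_pmf) simp

lemma char_fun_mu: "char_fun mu = phi"
proof
  fix t :: "real \<times> real"
  have "char_fun mu t = (LINT z|measure_pmf (pmf_of_set {(0, 1), (1, 0), (1, 1)}). iexp (t \<bullet> z))"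
    unfolding char_fun_def mu_eq_distr by (intro integral_distr) auto
  also have "\<dots> = phi t"
    by (cases t, subst integral_measure_pmf[of "{(0, 1), (1, 0), (1, 1)}"])
      (auto simp: phi_def scaleR_conv_of_real field_simps)
  finally show "char_fun mu t = phi t" .
qed

text \<open>At this point the three exponentials are the two primitive cube roots of unity and 1,
  which sum to zero.\<close>

lemma phi_zero: "phi (2 * pi / 3, - 2 * pi / 3) = 0"
  by (simp add: phi_def complex_eq_iff Re_exp Im_exp cos_120 sin_120)

lemma has_derivative_iexp:
  assumes "(h has_derivative h') (at z)"
  shows "((\<lambda>w. iexp (h w)) has_derivative (\<lambda>v. iexp (h z) * (\<i> * complex_of_real (h' v)))) (at z)"
proof -
  have "((\<lambda>w. \<i> * complex_of_real (h w)) has_derivative (\<lambda>v. \<i> * complex_of_real (h' v))) (at z)"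
    using assms by (intro has_derivative_mult_right has_derivative_of_real)
  from has_derivative_compose[OF this DERIV_exp[unfolded has_field_derivative_def]]
  show ?thesis by simp
qed

text \<open>Inserting the cube roots of unity separates real and imaginary parts. As a real 2x2
  matrix the derivative has determinant \<open>- sqrt 3 / 18\<close>, so the zero is
  nondegenerate.\<close>

lemma phi_has_derivative:
  "(phi has_derivative (\<lambda>(u, v). Complex (sqrt 3 / 6 * (v - u)) ((u + v) / 6)))
     (at (2 * pi / 3, - 2 * pi / 3))"
proof -
  let ?z = "(2 * pi / 3, - 2 * pi / 3)"
  have "((\<lambda>z. 1/3 * (iexp (fst z) + iexp (snd z) + iexp (fst z + snd z))) has_derivative
      (\<lambda>v. 1/3 * (iexp (fst ?z) * (\<i> * complex_of_real (fst v))
        + iexp (snd ?z) * (\<i> * complex_of_real (snd v))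
        + iexp (fst ?z + snd ?z) * (\<i> * complex_of_real (fst v + snd v))))) (at ?z)"
    by (intro has_derivative_mult_right has_derivative_add has_derivative_iexp
        has_derivative_fst has_derivative_snd has_derivative_ident)
  moreover have "(\<lambda>v. 1/3 * (iexp (fst ?z) * (\<i> * complex_of_real (fst v))
        + iexp (snd ?z) * (\<i> * complex_of_real (snd v))
        + iexp (fst ?z + snd ?z) * (\<i> * complex_of_real (fst v + snd v))))
      = (\<lambda>(u, v). Complex (sqrt 3 / 6 * (v - u)) ((u + v) / 6))"
    by (auto simp: fun_eq_iff complex_eq_iff Re_exp Im_exp cos_120' sin_120' field_simps)
  ultimately show ?thesis by (simp add: phi_def case_prod_unfold)
qed

theorem theorem1:
  "prob_space mu \<and> sets mu = sets borel \<and> char_fun mu = phi \<and>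
   \<not> (\<exists>g :: nat \<Rightarrow> real \<times> real \<Rightarrow> complex.
        (\<forall>n. continuous_on UNIV (g n)) \<and>
        (\<forall>n x y. g n (x, y) \<noteq> 0) \<and>
        (\<forall>K. compact K \<longrightarrow> uniform_limit K g phi sequentially))"
proof (intro conjI notI)
  show "prob_space mu" by (rule prob_space_mu)
  show "sets mu = sets borel" by (simp add: mu_eq_distr)
  show "char_fun mu = phi" by (rule char_fun_mu)
next
  \<comment> \<open>Solving \<open>Re c = sqrt 3 / 6 * (v - u)\<close> and
    \<open>Im c = (u + v) / 6\<close> for \<open>(u, v)\<close> gives this inverse of the
    derivative.\<close>
  let ?A = "\<lambda>c. (3 * Im c - sqrt 3 * Re c, 3 * Im c + sqrt 3 * Re c)"
  assume "\<exists>g :: nat \<Rightarrow> real \<times> real \<Rightarrow> complex.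
        (\<forall>n. continuous_on UNIV (g n)) \<and>
        (\<forall>n x y. g n (x, y) \<noteq> 0) \<and>
        (\<forall>K. compact K \<longrightarrow> uniform_limit K g phi sequentially)"
  then obtain g :: "nat \<Rightarrow> real \<times> real \<Rightarrow> complex" where
    g: "\<And>n. continuous_on UNIV (g n)" "\<And>n x y. g n (x, y) \<noteq> 0"
      "\<And>K. compact K \<Longrightarrow> uniform_limit K g phi sequentially"
    by blast
  have "bounded_linear ?A"
    by (intro bounded_linear_Pair bounded_linear_add bounded_linear_sub
        bounded_linear_const_mult bounded_linear_Re bounded_linear_Im)
  moreover have "inj ?A"
  proof (rule injI)
    fix c d assume "?A c = ?A d"
    then have "3 * Im c - sqrt 3 * Re c = 3 * Im d - sqrt 3 * Re d"
      and "3 * Im c + sqrt 3 * Re c = 3 * Im d + sqrt 3 * Re d" by simp_all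
    then have "Im c = Im d" "sqrt 3 * Re c = sqrt 3 * Re d" by linarith+
    then show "c = d" by (simp add: complex_eq_iff)
  qed
  moreover have "?A ((\<lambda>(u, v). Complex (sqrt 3 / 6 * (v - u)) ((u + v) / 6)) v) = v" for v
    by (cases v) (simp add: field_simps)
  ultimately have "\<forall>\<^sub>F n in sequentially. \<exists>w. g n w = 0"
    using nondegenerate_zero_stable[OF phi_has_derivative phi_zero] g(1,3) by blast
  then show False
    using g(2) by (force dest: eventually_happens)
qed

end
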